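(* Let $\mathcal H$ be any heuristic and consider the procedure $\mathrm{PrIC3}_{\mathcal H}(\mathfrak{M},B,\lambda)$ described in the context, in which $\mathrm{Strengthen}_{\mathcal H}$ is the procedure described in the context and $\mathrm{Propagate}$ does not affect the PrIC3 invariants. Then whenever $\mathrm{PrIC3}_{\mathcal H}(\mathfrak{M},B,\lambda)$ terminates returning $\mathit{safe}=\mathtt{true}$, we have $\Pr^{\max}(s_I\models\Diamond B)\le\lambda$.
   Context: An MDP $\mathfrak{M}=(S,s_I,\mathrm{Act},P)$ has finite state set $S$, initial state $s_I$, finite action set $\mathrm{Act}$, $P\colon S\times\mathrm{Act}\times S\to[0,1]$ with $\mathrm{Act}(s)=\{a\mid\exists s'.P(s,a,s')>0\}\neq\emptyset$ and $\sum_{s'}P(s,a,s')=1$ for $a\in\mathrm{Act}(s)$. Fix $B\subseteq S$, $\lambda\in[0,1]$. A frame is $F\colon S\to[0,1]$, ordered pointwise; $\mathbf 0,\mathbf 1$ are constant frames. $\Phi_a(F)[s]=1$ if $s\in B$ and $\sum_{s'}P(s,a,s')F[s']$ otherwise; $\Phi(F)[s]=1$ if $s\in B$ and $\max_{a\in\mathrm{Act}}\sum_{s'}P(s,a,s')F[s']$ otherwise; $\Pr^{\max}(s\models\Diamond B)=(\mathrm{lfp}\,\Phi)[s]$. $\mathrm{Inv}(F_0,\dots,F_m)$ (PrIC3 invariants) means $F_0=\Phi(\mathbf 0)$, $F_j\le F_{j+1}$ and $\Phi(F_j)\le F_{j+1}$ for $0\le j<m$, and $F_j[s_I]\le\lambda$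 for $0\le j\le m$. $\mathrm{Succs}(s,a)=\{s'\mid P(s,a,s')>0\}$ in a fixed order $s_1,\dots,s_n$; a heuristic $\mathcal H$ maps $(s,a,\delta)$ to values $\delta_1,\dots,\delta_n\in[0,1]$. $\mathrm{Strengthen}_{\mathcal H}(F_0,\dots,F_k)$: priority queue $Q$ of obligations $(i,s,\delta)$ popping minimal $i$, initially $\{(k,s_I,\lambda)\}$. While $Q\neq\emptyset$: pop $(i,s,\delta)$; if $i=0$ or ($s\in B$ and $\delta<1$), return $\mathtt{false}$ and the set of states that appeared in $Q$; else if some $a\in\mathrm{Act}(s)$ has $\Phi_a(F_{i-1})[s]>\delta$, pick such $a$, compute $\delta_1,\dots,\delta_n=\mathcal H(s,a,\delta)$, push $(i-1,s_j,\delta_j)$ for all $s_j\in\mathrm{Succs}(s,a)$ and push $(i,s,\delta)$; else set $F_j[s]\leftarrow\min(F_j[s],\delta)$ for $1\le j\le i$. When $Q$ is empty return $\mathtt{true}$, the frames, and the set of states that appeared in $Q$. $\mathrm{PrIC3}_{\mathcal H}$: set $F_0\leftarrow\Phi(\mathbf 0)$, $F_1\leftarrow\mathbf 1$, $k\leftarrow1$, $\mathit{old}\leftarrow\emptyset$; repeat: $(\mathit{success},F_0,\dots,F_k,\mathit{sub})\leftarrow\mathrm{Strengthen}_{\mathcal H}(F_0,\dots,F_k)$; if $\neg\mathit{success}$ return $(\mathtt{false},\mathit{sub})$; $F_{k+1}\leftarrow\mathbf 1$; $(F_0,\dots,F_{k+1})\leftarrow\mathrm{Propagate}(F_0,\dots,F_{k+1})$;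 if $F_i=F_{i+1}$ for some $1\le i\le k$ return $\mathtt{true}$; if $\mathit{old}=\mathit{sub}$ return $(\mathtt{false},\mathit{sub})$; $k\leftarrow k+1$, $\mathit{old}\leftarrow\mathit{sub}$. $\mathrm{Propagate}$ does not affect the PrIC3 invariants means: whenever called on $G_0,\dots,G_{k+1}$ with $\mathrm{Inv}(G_0,\dots,G_k)$, $G_k\le G_{k+1}$, $\Phi(G_k)\le G_{k+1}$, its output $G'_0,\dots,G'_{k+1}$ satisfies $\mathrm{Inv}(G'_0,\dots,G'_k)$, $G'_k\le G'_{k+1}$, $\Phi(G'_k)\le G'_{k+1}$. *)

theory Defs
  imports Complex_Main "HOL-Library.Multiset"
begin

text \<open>The finite state and action sets are the types \<open>'s\<close> and \<open>'a\<close>.\<close>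

record ('s, 'a) mdp =
  init :: 's
  prob :: "'s \<Rightarrow> 'a \<Rightarrow> 's \<Rightarrow> real"

definition Act :: "('s, 'a) mdp \<Rightarrow> 's \<Rightarrow> 'a set" where
  "Act M s = {a. \<exists>s'. prob M s a s' > 0}"

definition wf_mdp :: "('s::finite, 'a::finite) mdp \<Rightarrow> bool" where
  "wf_mdp M \<longleftrightarrow>
     (\<forall>s a s'. prob M s a s' \<in> {0..1}) \<and>
     (\<forall>s. Act M s \<noteq> {}) \<and>
     (\<forall>s. \<forall>a\<in>Act M s. (\<Sum>s'\<in>UNIV. prob M s a s') = 1)"

type_synonym 's frame = "'s \<Rightarrow> real"

definition frames :: "'s frame set" where
  "frames = {F. \<forall>s. F s \<in> {0..1}}"

definition Phi_act :: "('s::finite, 'a) mdp \<Rightarrow> 's set \<Rightarrow> 'a \<Rightarrow> 's frame \<Rightarrow> 's frame" where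
  "Phi_act M B a F s = (if s \<in> B then 1 else (\<Sum>s'\<in>UNIV. prob M s a s' * F s'))"

definition Phi :: "('s::finite, 'a::finite) mdp \<Rightarrow> 's set \<Rightarrow> 's frame \<Rightarrow> 's frame" where
  "Phi M B F s = (if s \<in> B then 1 else (MAX a\<in>UNIV. \<Sum>s'\<in>UNIV. prob M s a s' * F s'))"

text \<open>Since \<^typ>\<open>real\<close> is not a complete lattice, the constant \<^const>\<open>lfp\<close> does not apply; the
  least fixed point is taken among the frames, in the pointwise order. It exists by the lemma
  \<open>Pr_max_least_fixpoint\<close> below.\<close>

definition Pr_max :: "('s::finite, 'a::finite) mdp \<Rightarrow> 's set \<Rightarrow> 's \<Rightarrow> real" where
  "Pr_max M B = (LEAST F. F \<in> frames \<and> Phi M B F = F)"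

text \<open>The list \<open>Fs\<close> stands for the sequence \<open>F\<^sub>0, \<dots>, F\<^sub>m\<close> with \<open>m + 1 = length Fs\<close>.\<close>

definition PrIC3_inv ::
  "('s::finite, 'a::finite) mdp \<Rightarrow> 's set \<Rightarrow> real \<Rightarrow> 's frame list \<Rightarrow> bool" where
  "PrIC3_inv M B lam Fs \<longleftrightarrow>
     Fs \<noteq> [] \<and> set Fs \<subseteq> frames \<and>
     Fs ! 0 = Phi M B (\<lambda>_. 0) \<and>
     (\<forall>j. Suc j < length Fs \<longrightarrow> Fs ! j \<le> Fs ! Suc j \<and> Phi M B (Fs ! j) \<le> Fs ! Suc j) \<and>
     (\<forall>j < length Fs. (Fs ! j) (init M) \<le> lam)"

definition succ_enum :: "('s, 'a) mdp \<Rightarrow> ('s \<Rightarrow> 'a \<Rightarrow> 's list) \<Rightarrow> bool" where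
  "succ_enum M succs \<longleftrightarrow>
     (\<forall>s a. distinct (succs s a) \<and> set (succs s a) = {s'. prob M s a s' > 0})"

definition heuristic ::
  "('s \<Rightarrow> 'a \<Rightarrow> 's list) \<Rightarrow> ('s \<Rightarrow> 'a \<Rightarrow> real \<Rightarrow> real list) \<Rightarrow> bool" where
  "heuristic succs H \<longleftrightarrow>
     (\<forall>s a. \<forall>\<delta>\<in>{0..1}. length (H s a \<delta>) = length (succs s a) \<and> set (H s a \<delta>) \<subseteq> {0..1})"

type_synonym 's obligation = "nat \<times> 's \<times> real"

definition pops :: "'s obligation multiset \<Rightarrow> 's obligation \<Rightarrow> 's obligation multiset \<Rightarrow> bool" where
  "pops Q ob Q' \<longleftrightarrow> ob \<in># Q \<and> (\<forall>ob'\<in>#Q. fst ob \<le> fst ob') \<and> Q' = Q - {#ob#}"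

definition lower :: "nat \<Rightarrow> 's \<Rightarrow> real \<Rightarrow> 's frame list \<Rightarrow> 's frame list" where
  "lower i s \<delta> Fs =
     map (\<lambda>j. if 1 \<le> j \<and> j \<le> i then (Fs ! j)(s := min ((Fs ! j) s) \<delta>) else Fs ! j)
       [0..<length Fs]"

datatype 's strengthen_result =
  Strengthen_False "'s set"
| Strengthen_True "'s frame list" "'s set"

text \<open>\<open>strengthen_loop M B succs H Q Fs T r\<close>: from the queue \<open>Q\<close>, the frames \<open>Fs\<close> and the set
  \<open>T\<close> of states that have appeared in the queue so far, the loop can terminate with result \<open>r\<close>.
  The choice among minimal obligations and among violating actions is nondeterministic;
  nonterminating runs have no result.\<close>

inductive strengthen_loop ::
  "('s::finite, 'a) mdp \<Rightarrow> 's set \<Rightarrow> ('s \<Rightarrow> 'a \<Rightarrow> 's list) \<Rightarrow> ('s \<Rightarrow> 'a \<Rightarrow> real \<Rightarrow> real list) \<Rightarrow>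
   's obligation multiset \<Rightarrow> 's frame list \<Rightarrow> 's set \<Rightarrow> 's strengthen_result \<Rightarrow> bool"
  for M B succs H where
  finish:
    "strengthen_loop M B succs H {#} Fs T (Strengthen_True Fs T)"
| fail:
    "\<lbrakk> pops Q (i, s, \<delta>) Q'; i = 0 \<or> (s \<in> B \<and> \<delta> < 1) \<rbrakk>
     \<Longrightarrow> strengthen_loop M B succs H Q Fs T (Strengthen_False T)"
| push:
    "\<lbrakk> pops Q (i, s, \<delta>) Q'; \<not> (i = 0 \<or> (s \<in> B \<and> \<delta> < 1));
       a \<in> Act M s; Phi_act M B a (Fs ! (i - 1)) s > \<delta>;
       strengthen_loop M B succs H
         (Q' + mset (map (\<lambda>(s', \<delta>'). (i - 1, s', \<delta>')) (zip (succs s a) (H s a \<delta>)))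
             + {#(i, s, \<delta>)#})
         Fs (T \<union> set (succs s a)) r \<rbrakk>
     \<Longrightarrow> strengthen_loop M B succs H Q Fs T r"
| update:
    "\<lbrakk> pops Q (i, s, \<delta>) Q'; \<not> (i = 0 \<or> (s \<in> B \<and> \<delta> < 1));
       \<not> (\<exists>a\<in>Act M s. Phi_act M B a (Fs ! (i - 1)) s > \<delta>);
       strengthen_loop M B succs H Q' (lower i s \<delta> Fs) T r \<rbrakk>
     \<Longrightarrow> strengthen_loop M B succs H Q Fs T r"

definition Strengthen ::
  "('s::finite, 'a) mdp \<Rightarrow> 's set \<Rightarrow> real \<Rightarrow> ('s \<Rightarrow> 'a \<Rightarrow> 's list) \<Rightarrow>
   ('s \<Rightarrow> 'a \<Rightarrow> real \<Rightarrow> real list) \<Rightarrow> nat \<Rightarrow> 's frame list \<Rightarrow> 's strengthen_result \<Rightarrow> bool" where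
  "Strengthen M B lam succs H k Fs r \<longleftrightarrow>
     strengthen_loop M B succs H {#(k, init M, lam)#} Fs {init M} r"

text \<open>Propagation is a relation between input and possible output sequences, so it may be
  partial or nondeterministic.\<close>

definition propagate_pre ::
  "('s::finite, 'a::finite) mdp \<Rightarrow> 's set \<Rightarrow> real \<Rightarrow> nat \<Rightarrow> 's frame list \<Rightarrow> bool" where
  "propagate_pre M B lam k Gs \<longleftrightarrow>
     length Gs = k + 2 \<and> set Gs \<subseteq> frames \<and> PrIC3_inv M B lam (take (k + 1) Gs) \<and>
     Gs ! k \<le> Gs ! (k + 1) \<and> Phi M B (Gs ! k) \<le> Gs ! (k + 1)"

definition preserves_PrIC3_inv ::
  "('s::finite, 'a::finite) mdp \<Rightarrow> 's set \<Rightarrow> real \<Rightarrow>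
   ('s frame list \<Rightarrow> 's frame list \<Rightarrow> bool) \<Rightarrow> bool" where
  "preserves_PrIC3_inv M B lam Propagate \<longleftrightarrow>
     (\<forall>k\<ge>1. \<forall>Gs Gs'. propagate_pre M B lam k Gs \<and> Propagate Gs Gs' \<longrightarrow> propagate_pre M B lam k Gs')"

datatype 's PrIC3_result = Safe_True | Safe_False "'s set"

text \<open>\<open>PrIC3_loop M B lam succs H Propagate k Fs old r\<close>: an iteration started with the frames
  \<open>Fs\<close>, i.e. \<open>F\<^sub>0, \<dots>, F\<^sub>k\<close>, can lead to termination with result \<open>r\<close>.\<close>

inductive PrIC3_loop ::
  "('s::finite, 'a) mdp \<Rightarrow> 's set \<Rightarrow> real \<Rightarrow> ('s \<Rightarrow> 'a \<Rightarrow> 's list) \<Rightarrow>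
   ('s \<Rightarrow> 'a \<Rightarrow> real \<Rightarrow> real list) \<Rightarrow> ('s frame list \<Rightarrow> 's frame list \<Rightarrow> bool) \<Rightarrow>
   nat \<Rightarrow> 's frame list \<Rightarrow> 's set \<Rightarrow> 's PrIC3_result \<Rightarrow> bool"
  for M B lam succs H Propagate where
  not_strengthened:
    "Strengthen M B lam succs H k Fs (Strengthen_False sub)
     \<Longrightarrow> PrIC3_loop M B lam succs H Propagate k Fs old (Safe_False sub)"
| converged:
    "\<lbrakk> Strengthen M B lam succs H k Fs (Strengthen_True Fs' sub);
       Propagate (Fs' @ [\<lambda>_. 1]) Gs;
       \<exists>i. 1 \<le> i \<and> i \<le> k \<and> Gs ! i = Gs ! (i + 1) \<rbrakk>
     \<Longrightarrow> PrIC3_loop M B lam succs H Propagate k Fs old Safe_True"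
| stagnated:
    "\<lbrakk> Strengthen M B lam succs H k Fs (Strengthen_True Fs' sub);
       Propagate (Fs' @ [\<lambda>_. 1]) Gs;
       \<not> (\<exists>i. 1 \<le> i \<and> i \<le> k \<and> Gs ! i = Gs ! (i + 1));
       old = sub \<rbrakk>
     \<Longrightarrow> PrIC3_loop M B lam succs H Propagate k Fs old (Safe_False sub)"
| continue:
    "\<lbrakk> Strengthen M B lam succs H k Fs (Strengthen_True Fs' sub);
       Propagate (Fs' @ [\<lambda>_. 1]) Gs;
       \<not> (\<exists>i. 1 \<le> i \<and> i \<le> k \<and> Gs ! i = Gs ! (i + 1));
       old \<noteq> sub;
       PrIC3_loop M B lam succs H Propagate (k + 1) Gs sub r \<rbrakk>
     \<Longrightarrow> PrIC3_loop M B lam succs H Propagate k Fs old r"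

definition PrIC3 ::
  "('s::finite, 'a::finite) mdp \<Rightarrow> 's set \<Rightarrow> real \<Rightarrow> ('s \<Rightarrow> 'a \<Rightarrow> 's list) \<Rightarrow>
   ('s \<Rightarrow> 'a \<Rightarrow> real \<Rightarrow> real list) \<Rightarrow> ('s frame list \<Rightarrow> 's frame list \<Rightarrow> bool) \<Rightarrow>
   's PrIC3_result \<Rightarrow> bool" where
  "PrIC3 M B lam succs H Propagate r \<longleftrightarrow>
     PrIC3_loop M B lam succs H Propagate 1 [Phi M B (\<lambda>_. 0), \<lambda>_. 1] {} r"

lemma Phi_mono:
  assumes "wf_mdp M" "F \<le> G"
  shows "Phi M B F \<le> Phi M B G"
proof (rule le_funI)
  fix s
  have "(\<Sum>s'\<in>UNIV. prob M s a s' * F s') \<le> (MAX a\<in>UNIV. \<Sum>s'\<in>UNIV. prob M s a s' * G s')"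
    (is "?l \<le> _") for a
  proof -
    have "?l \<le> (\<Sum>s'\<in>UNIV. prob M s a s' * G s')"
      using assms by (intro sum_mono mult_left_mono) (auto simp: wf_mdp_def le_fun_def)
    also have "\<dots> \<le> (MAX a\<in>UNIV. \<Sum>s'\<in>UNIV. prob M s a s' * G s')"
      by (intro Max_ge) auto
    finally show ?thesis .
  qed
  then show "Phi M B F s \<le> Phi M B G s"
    by (auto simp: Phi_def)
qed

lemma Phi_frames:
  assumes "wf_mdp M" "F \<in> frames"
  shows "Phi M B F \<in> frames"
proof -
  have nn: "0 \<le> (\<Sum>s'\<in>UNIV. prob M s a s' * F s')" for s a
    using assms by (intro sum_nonneg mult_nonneg_nonneg) (auto simp: wf_mdp_def frames_def)
  have le1: "(\<Sum>s'\<in>UNIV. prob M s a s' * F s') \<le> 1" for s a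
  proof (cases "a \<in> Act M s")
    case True
    have "(\<Sum>s'\<in>UNIV. prob M s a s' * F s') \<le> (\<Sum>s'\<in>UNIV. prob M s a s' * 1)"
      using assms by (intro sum_mono mult_left_mono) (auto simp: wf_mdp_def frames_def)
    with True assms show ?thesis by (simp add: wf_mdp_def)
  next
    case False
    then have "prob M s a s' = 0" for s'
      using assms by (force simp: wf_mdp_def Act_def not_less intro: antisym)
    then show ?thesis by simp
  qed
  have "(MAX a\<in>UNIV. \<Sum>s'\<in>UNIV. prob M s a s' * F s') \<in> {0..1}" for s
  proof -
    have "(MAX a\<in>UNIV. \<Sum>s'\<in>UNIV. prob M s a s' * F s')
        \<in> range (\<lambda>a. \<Sum>s'\<in>UNIV. prob M s a s' * F s')"
      by (intro Max_in) auto
    then obtain a where "(MAX a\<in>UNIV. \<Sum>s'\<in>UNIV. prob M s a s' * F s')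
        = (\<Sum>s'\<in>UNIV. prob M s a s' * F s')"
      by blast
    then show ?thesis using nn[of s a] le1[of s a] by simp
  qed
  then show ?thesis by (auto simp: frames_def Phi_def)
qed

lemma Pr_max_least_fixpoint:
  assumes M: "wf_mdp M"
  shows "Pr_max M B \<in> frames" "Phi M B (Pr_max M B) = Pr_max M B"
    and "\<And>G. G \<in> frames \<Longrightarrow> Phi M B G \<le> G \<Longrightarrow> Pr_max M B \<le> G"
proof -
  define A where "A = {G \<in> frames. Phi M B G \<le> G}"
  define L where "L = (\<lambda>s. INF G\<in>A. G s)"
  have one: "(\<lambda>_. 1) \<in> A"
    using Phi_frames[OF M, of "\<lambda>_. 1" B] by (auto simp: A_def frames_def le_fun_def)
  have bdd: "bdd_below ((\<lambda>G. G s) ` A)" for s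
    by (rule bdd_belowI[of _ 0]) (auto simp: A_def frames_def)
  have lb: "L \<le> G" if "G \<in> A" for G
    unfolding L_def le_fun_def using that bdd by (auto intro: cINF_lower)
  have ge: "F \<le> L" if "\<And>G. G \<in> A \<Longrightarrow> F \<le> G" for F
    unfolding L_def le_fun_def using that one by (auto intro!: cINF_greatest simp: le_fun_def)
  have Lf: "L \<in> frames"
    using lb[OF one] ge[of "\<lambda>_. 0"] by (auto simp: frames_def A_def le_fun_def)
  have 1: "Phi M B L \<le> L"
    using Phi_mono[OF M lb] by (intro ge) (auto simp: A_def intro: order_trans)
  have "Phi M B L \<in> A"
    using Phi_frames[OF M Lf] Phi_mono[OF M 1] by (auto simp: A_def)
  then have fp: "Phi M B L = L" using 1 lb by (auto intro: antisym)
  have "Pr_max M B = L"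
    unfolding Pr_max_def by (rule Least_equality) (auto simp: Lf fp intro!: lb, simp add: A_def)
  then show "Pr_max M B \<in> frames" "Phi M B (Pr_max M B) = Pr_max M B"
    and "\<And>G. G \<in> frames \<Longrightarrow> Phi M B G \<le> G \<Longrightarrow> Pr_max M B \<le> G"
    using Lf fp lb by (auto simp: A_def)
qed

end

theory Submission
  imports Defs
begin

text \<open>The chain conditions \<open>F\<^sub>j \<le> F\<^sub>j\<^sub>+\<^sub>1\<close> and \<open>\<Phi>(F\<^sub>j) \<le> F\<^sub>j\<^sub>+\<^sub>1\<close> survive every update of an obligation
  \<open>(i, s, \<delta>)\<close>: no action violates \<open>\<delta>\<close> at level \<open>i - 1\<close>, hence by monotonicity none does at any
  lower level. Only \<open>F\<^sub>k(s\<^sub>I) \<le> \<lambda>\<close> can fail during strengthening, and it is restored because the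
  initial obligation \<open>(k, s\<^sub>I, \<lambda>)\<close> leaves the queue only through an update. When two neighbouring
  frames \<open>F\<^sub>i = F\<^sub>i\<^sub>+\<^sub>1\<close> coincide, \<open>F\<^sub>i\<close> is a pre-fixed point of \<open>\<Phi>\<close>, so it bounds the least fixed
  point.\<close>

text \<open>\<open>PrIC3_inv\<close> without the bound at \<open>init M\<close>: the part that also
  holds in the middle of a strengthening run and for the initial frames, whose last member is
  constantly 1 and may exceed \<open>lam\<close>.\<close>

definition frame_chain ::
  "('s::finite, 'a::finite) mdp \<Rightarrow> 's set \<Rightarrow> 's frame list \<Rightarrow> bool" where
  "frame_chain M B Fs \<longleftrightarrow>
     set Fs \<subseteq> frames \<and> Fs ! 0 = Phi M B (\<lambda>_. 0) \<and>
     (\<forall>j. Suc j < length Fs \<longrightarrow> Fs ! j \<le> Fs ! Suc j \<and> Phi M B (Fs ! j) \<le> Fs ! Suc j)"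

lemma frame_chain_mono:
  assumes "frame_chain M B Fs" "i \<le> j" "j < length Fs"
  shows "Fs ! i \<le> Fs ! j"
  using assms(2,3)
proof (induction j rule: dec_induct)
  case (step n)
  then have "Fs ! n \<le> Fs ! Suc n"
    using assms(1) by (simp add: frame_chain_def)
  moreover have "Fs ! i \<le> Fs ! n"
    using step by simp
  ultimately show ?case
    by (rule order_trans[rotated])
qed simp

text \<open>Frames increase along a chain, so the bound at the last frame yields all others, and
  strengthening has a single value to control.\<close>

lemma PrIC3_inv_iff_frame_chain:
  "PrIC3_inv M B lam Fs \<longleftrightarrow>
     Fs \<noteq> [] \<and> frame_chain M B Fs \<and> (Fs ! (length Fs - 1)) (init M) \<le> lam"
proof
  assume "PrIC3_inv M B lam Fs"
  then show "Fs \<noteq> [] \<and> frame_chain M B Fs \<and> (Fs ! (length Fs - 1)) (init M) \<le> lam"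
    by (auto simp: PrIC3_inv_def frame_chain_def)
next
  assume r: "Fs \<noteq> [] \<and> frame_chain M B Fs \<and> (Fs ! (length Fs - 1)) (init M) \<le> lam"
  have "(Fs ! j) (init M) \<le> lam" if "j < length Fs" for j
  proof -
    have "Fs ! j \<le> Fs ! (length Fs - 1)"
      using r that by (intro frame_chain_mono) auto
    then show ?thesis
      using r by (meson le_funD order_trans)
  qed
  then show "PrIC3_inv M B lam Fs"
    using r by (auto simp: PrIC3_inv_def frame_chain_def)
qed

lemma frame_chain_snoc:
  assumes "Fs \<noteq> []"
  shows "frame_chain M B (Fs @ [G]) \<longleftrightarrow>
     frame_chain M B Fs \<and> G \<in> frames \<and> Fs ! (length Fs - 1) \<le> G \<and>
     Phi M B (Fs ! (length Fs - 1)) \<le> G"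
proof -
  obtain n where n: "length Fs = Suc n"
    using assms by (cases Fs) auto
  have "(Fs @ [G]) ! j = Fs ! j" if "j \<le> n" for j
    using n that by (simp add: nth_append)
  moreover have "(Fs @ [G]) ! Suc n = G"
    using n by (simp add: nth_append)
  ultimately show ?thesis
    unfolding frame_chain_def by (simp add: n All_less_Suc) (meson less_imp_le Suc_leI)
qed

text \<open>The bound sits at index \<open>k\<close>, the last but one, because the frame appended
  after strengthening is constantly 1.\<close>

lemma propagate_pre_iff:
  "propagate_pre M B lam k Gs \<longleftrightarrow>
     length Gs = k + 2 \<and> frame_chain M B Gs \<and> (Gs ! k) (init M) \<le> lam"
proof (cases "length Gs = k + 2")
  case True
  define Fs G where "Fs = take (k + 1) Gs" and "G = Gs ! (k + 1)"
  have Gs: "Gs = Fs @ [G]" and Fs: "Fs \<noteq> []" "length Fs = k + 1"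
    using True by (auto simp: Fs_def G_def take_Suc_conv_app_nth[symmetric])
  have "Fs ! k = Gs ! k"
    using Fs by (simp add: Gs nth_append)
  moreover have "set Gs \<subseteq> frames \<longleftrightarrow> set Fs \<subseteq> frames \<and> G \<in> frames"
    by (auto simp: Gs)
  moreover have "frame_chain M B Gs \<longleftrightarrow>
      frame_chain M B Fs \<and> G \<in> frames \<and> Fs ! k \<le> G \<and> Phi M B (Fs ! k) \<le> G"
    using Fs by (simp add: Gs frame_chain_snoc)
  moreover have "set Fs \<subseteq> frames" if "frame_chain M B Fs"
    using that by (simp add: frame_chain_def)
  ultimately show ?thesis
    using True Fs
    unfolding propagate_pre_def PrIC3_inv_iff_frame_chain Fs_def[symmetric] G_def[symmetric]
    by auto
qed (simp add: propagate_pre_def)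

text \<open>The loop tests enabled actions only, whereas \<open>Phi\<close> maximizes over all of
  them. A disabled action contributes the sum 0, which is harmless since \<delta> is
  nonnegative.\<close>

lemma Phi_le_if_Phi_act_le:
  assumes "wf_mdp M" "0 \<le> \<delta>" "\<And>a. a \<in> Act M s \<Longrightarrow> Phi_act M B a F s \<le> \<delta>"
  shows "Phi M B F s \<le> \<delta>"
proof (cases "s \<in> B")
  case True
  \<comment> \<open>On \<open>B\<close> the value is 1, and an enabled action is needed for the
    hypothesis to give 1 \<le> \<delta>.\<close>
  obtain a where "a \<in> Act M s"
    using assms(1) by (meson all_not_in_conv wf_mdp_def)
  then show ?thesis
    using assms(3)[of a] True by (simp add: Phi_def Phi_act_def)
next
  case False
  have "(\<Sum>s'\<in>UNIV. prob M s a s' * F s') \<le> \<delta>" for a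
  proof (cases "a \<in> Act M s")
    case True
    then show ?thesis
      using assms(3)[of a] False by (simp add: Phi_act_def)
  next
    case False
    then have "prob M s a s' = 0" for s'
      using assms(1) by (force simp: wf_mdp_def Act_def not_less intro: antisym)
    then show ?thesis
      using assms(2) by simp
  qed
  then show ?thesis
    using False by (simp add: Phi_def)
qed

lemma length_lower [simp]: "length (lower i s \<delta> Fs) = length Fs"
  by (simp add: lower_def)

lemma nth_lower:
  "j < length Fs \<Longrightarrow>
     lower i s \<delta> Fs ! j =
       (if 1 \<le> j \<and> j \<le> i then (Fs ! j)(s := min ((Fs ! j) s) \<delta>) else Fs ! j)"
  by (simp add: lower_def)

lemma nth_lower_le: "j < length Fs \<Longrightarrow> lower i s \<delta> Fs ! j \<le> Fs ! j"
  by (auto simp: nth_lower le_fun_def)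

text \<open>Smaller left-hand sides keep the inequalities, as \<open>Phi\<close> is monotone.
  Right-hand sides shrink only at \<open>s\<close> on levels 1 to \<open>i\<close>, so there both
  left-hand sides must be shown to be at most \<delta>.\<close>

lemma frame_chain_lower:
  assumes M: "wf_mdp M" and ch: "frame_chain M B Fs"
    and i: "0 < i" "i < length Fs"
    and \<delta>: "\<delta> \<in> {0..1}" "s \<in> B \<Longrightarrow> 1 \<le> \<delta>"
    and le: "\<And>a. a \<in> Act M s \<Longrightarrow> Phi_act M B a (Fs ! (i - 1)) s \<le> \<delta>"
  shows "frame_chain M B (lower i s \<delta> Fs)"
proof -
  let ?L = "lower i s \<delta> Fs"
  have Phi_le: "Phi M B (Fs ! (i - 1)) s \<le> \<delta>"
    using M \<delta>(1) le by (intro Phi_le_if_Phi_act_le) auto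
  have L_frames: "?L ! j \<in> frames" if "j < length Fs" for j
  proof -
    have "Fs ! j \<in> frames"
      using ch that by (auto simp: frame_chain_def)
    then show ?thesis
      using \<delta>(1) that by (auto simp: nth_lower frames_def min_def)
  qed
  have "Fs \<noteq> []"
    using i by auto
  then have L0: "?L ! 0 = Phi M B (\<lambda>_. 0)"
    using ch by (simp add: nth_lower frame_chain_def)
  have step: "?L ! j \<le> ?L ! Suc j \<and> Phi M B (?L ! j) \<le> ?L ! Suc j" if j: "Suc j < length Fs" for j
  proof -
    have ord: "Fs ! j \<le> Fs ! Suc j" "Phi M B (Fs ! j) \<le> Fs ! Suc j"
      using ch j by (auto simp: frame_chain_def)
    have low: "?L ! j \<le> Fs ! j"
      using j by (simp add: nth_lower_le)
    have Phi_low: "Phi M B (?L ! j) \<le> Phi M B (Fs ! j)"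
      using M low by (rule Phi_mono)
    show ?thesis
    proof (cases "Suc j \<le> i")
      case False
      then show ?thesis
        using ord low Phi_low j by (auto simp: nth_lower)
    next
      case True
      have LSuc: "?L ! Suc j = (Fs ! Suc j)(s := min ((Fs ! Suc j) s) \<delta>)"
        using True j by (simp add: nth_lower)
      have "(?L ! j) s \<le> \<delta>"
      proof (cases "j = 0")
        \<comment> \<open>Frame 0 is never lowered. At \<open>s\<close> it is 0 off \<open>B\<close>
          and 1 on \<open>B\<close>, where \<delta> is at least 1.\<close>
        case True
        then show ?thesis
          using \<delta> by (auto simp: L0 Phi_def)
      next
        case False
        then show ?thesis
          using True j by (simp add: nth_lower)
      qed
      moreover have "Phi M B (?L ! j) s \<le> \<delta>"
      proof -
        have "Fs ! j \<le> Fs ! (i - 1)"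
          using ch True i by (intro frame_chain_mono) auto
        then have "Phi M B (?L ! j) \<le> Phi M B (Fs ! (i - 1))"
          using Phi_low Phi_mono[OF M] order_trans by blast
        then show ?thesis
          using Phi_le by (meson le_funD order_trans)
      qed
      moreover have "?L ! j \<le> Fs ! Suc j" "Phi M B (?L ! j) \<le> Fs ! Suc j"
        using ord low Phi_low by (auto intro: order_trans)
      ultimately show ?thesis
        by (auto simp: LSuc le_fun_def)
    qed
  qed
  show ?thesis
    using L_frames L0 step by (auto simp: frame_chain_def in_set_conv_nth)
qed

text \<open>The last premise is the invariant for the bound: its obligation is still queued or
  already met. An empty queue leaves only the second alternative.\<close>

lemma strengthen_loop_True:
  assumes "strengthen_loop M B succs H Q Fs T r"
    and M: "wf_mdp M" and H: "heuristic succs H" and k: "0 < k"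
    and "r = Strengthen_True Fs' sub"
    and "length Fs = k + 1" and "frame_chain M B Fs"
    and "\<And>i s \<delta>. (i, s, \<delta>) \<in># Q \<Longrightarrow> i \<le> k \<and> \<delta> \<in> {0..1}"
    and "(k, s0, lam) \<in># Q \<or> (Fs ! k) s0 \<le> lam"
  shows "length Fs' = k + 1 \<and> frame_chain M B Fs' \<and> (Fs' ! k) s0 \<le> lam"
  using assms(1,5-)
proof (induction rule: strengthen_loop.induct)
  case (finish Fs T)
  then show ?case by simp
next
  case (fail Q i s \<delta> Q' Fs T)
  then show ?case by simp
next
  case (push Q i s \<delta> Q' a Fs T r)
  have ob: "(i, s, \<delta>) \<in># Q" and Q': "Q' = Q - {#(i, s, \<delta>)#}"
    using push.hyps(1) by (auto simp: pops_def)
  have i: "i \<le> k" and \<delta>: "\<delta> \<in> {0..1}"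
    using push.prems(4)[OF ob] by auto
  have Q: "Q = Q' + {#(i, s, \<delta>)#}"
    using ob by (simp add: Q')
  have H': "\<delta>' \<in> {0..1}" if "(s', \<delta>') \<in> set (zip (succs s a) (H s a \<delta>))" for s' \<delta>'
    using H \<delta> set_zip_rightD[OF that] unfolding heuristic_def by blast
  show ?case
  proof (rule push.IH)
    fix i' s' \<delta>'
    assume "(i', s', \<delta>') \<in>#
      Q' + mset (map (\<lambda>(s', \<delta>'). (i - 1, s', \<delta>')) (zip (succs s a) (H s a \<delta>))) + {#(i, s, \<delta>)#}"
    then consider "(i', s', \<delta>') \<in># Q"
      | "i' = i - 1" "(s', \<delta>') \<in> set (zip (succs s a) (H s a \<delta>))"
      by (auto simp: Q)
    then show "i' \<le> k \<and> \<delta>' \<in> {0..1}"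
    proof cases
      case 1
      then show ?thesis by (rule push.prems(4))
    next
      case 2
      then show ?thesis using i H' by auto
    qed
  \<comment> \<open>The popped obligation is pushed back, so \<open>(k, s0, lam)\<close> stays
    queued if it was.\<close>
  qed (use push.prems in \<open>auto simp: Q\<close>)
next
  case (update Q i s \<delta> Q' Fs T r)
  have ob: "(i, s, \<delta>) \<in># Q" and Q': "Q' = Q - {#(i, s, \<delta>)#}"
    using update.hyps(1) by (auto simp: pops_def)
  have i: "i \<le> k" "0 < i" and \<delta>: "\<delta> \<in> {0..1}"
    using update.prems(4)[OF ob] update.hyps(2) by auto
  have Q: "Q = Q' + {#(i, s, \<delta>)#}"
    using ob by (simp add: Q')
  have bound: "(k, s0, lam) \<in># Q' \<or> (lower i s \<delta> Fs ! k) s0 \<le> lam"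
  proof (cases "(k, s0, lam) = (i, s, \<delta>)")
    \<comment> \<open>The minimum with \<open>lam\<close> is taken at index \<open>k\<close> because
      \<open>k\<close> is positive; index 0 would be left alone.\<close>
    case True
    then show ?thesis
      using k update.prems(2) by (auto simp: nth_lower)
  next
    case False
    then have "(k, s0, lam) \<in># Q' \<or> (Fs ! k) s0 \<le> lam"
      using update.prems(5) by (auto simp: Q)
    moreover have "(lower i s \<delta> Fs ! k) s0 \<le> (Fs ! k) s0"
      using nth_lower_le[of k Fs i s \<delta>] update.prems(2) by (auto simp: le_fun_def)
    ultimately show ?thesis by auto
  qed
  show ?case
  proof (rule update.IH)
    show "frame_chain M B (lower i s \<delta> Fs)"
      using i \<delta> update.prems(2,3) update.hyps(2,3)
      by (intro frame_chain_lower[OF M]) (auto simp: not_less)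
  qed (use update.prems bound in \<open>auto simp: Q\<close>)
qed

lemma PrIC3_loop_Safe_True:
  assumes "PrIC3_loop M B lam succs H Propagate k Fs old r"
    and M: "wf_mdp M" and lam: "lam \<in> {0..1}" and H: "heuristic succs H"
    and P: "preserves_PrIC3_inv M B lam Propagate"
    and "r = Safe_True" "0 < k" "length Fs = k + 1" "frame_chain M B Fs"
  shows "Pr_max M B (init M) \<le> lam"
proof -
  \<comment> \<open>One pass of strengthening and propagation, shared by the converged and the
    continuing case. Its output has the length required for \<open>k + 1\<close>.\<close>
  have iter: "length Gs = k + 2 \<and> frame_chain M B Gs \<and> (Gs ! k) (init M) \<le> lam"
    if k: "0 < k" and Fs: "length Fs = k + 1" "frame_chain M B Fs"
      and S: "Strengthen M B lam succs H k Fs (Strengthen_True Fs' sub)"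
      and G: "Propagate (Fs' @ [\<lambda>_. 1]) Gs"
    for k Fs Fs' sub Gs
  proof -
    have Fs': "length Fs' = k + 1 \<and> frame_chain M B Fs' \<and> (Fs' ! k) (init M) \<le> lam"
      using S[unfolded Strengthen_def] M H k refl Fs
      by (rule strengthen_loop_True) (use lam in auto)
    then have "Fs' ! k \<in> frames"
      by (auto simp: frame_chain_def)
    then have "frame_chain M B (Fs' @ [\<lambda>_. 1])"
      using Fs' Phi_frames[OF M, of "Fs' ! k" B]
      by (subst frame_chain_snoc) (auto simp: frames_def le_fun_def)
    with Fs' have "propagate_pre M B lam k (Fs' @ [\<lambda>_. 1])"
      by (simp add: propagate_pre_iff nth_append)
    then have "propagate_pre M B lam k Gs"
      using P G k unfolding preserves_PrIC3_inv_def by (metis One_nat_def Suc_leI)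
    then show ?thesis
      by (simp add: propagate_pre_iff)
  qed
  show ?thesis
    using assms(1,6-)
  proof (induction rule: PrIC3_loop.induct)
    case (converged k Fs Fs' sub Gs old)
    then obtain i where i: "i \<le> k" "Gs ! i = Gs ! (i + 1)"
      by blast
    have Gs: "length Gs = k + 2" "frame_chain M B Gs" "(Gs ! k) (init M) \<le> lam"
      using iter converged by blast+
    have "Gs ! i \<in> frames" "Phi M B (Gs ! i) \<le> Gs ! (i + 1)"
      using Gs(1,2) i(1) by (auto simp: frame_chain_def)
    then have "Pr_max M B \<le> Gs ! i"
      unfolding i(2)[symmetric] by (rule Pr_max_least_fixpoint[OF M])
    \<comment> \<open>Here \<open>i \<le> k\<close> matters: \<open>Gs ! (k + 1)\<close> carries no
      bound at \<open>init M\<close>.\<close>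
    also have "Gs ! i \<le> Gs ! k"
      using Gs(1,2) i(1) by (intro frame_chain_mono) auto
    finally show ?case
      using Gs(3) by (meson le_funD order_trans)
  next
    case (continue k Fs Fs' sub Gs old r)
    then show ?case
      using iter[OF continue.prems(2-4) continue.hyps(1,2)] by simp
  qed auto
qed

theorem theorem3:
  fixes M :: "('s::finite, 'a::finite) mdp"
    and B :: "'s set"
    and lam :: real
    and succs :: "'s \<Rightarrow> 'a \<Rightarrow> 's list"
    and H :: "'s \<Rightarrow> 'a \<Rightarrow> real \<Rightarrow> real list"
    and Propagate :: "'s frame list \<Rightarrow> 's frame list \<Rightarrow> bool"
  assumes "wf_mdp M"
    and "lam \<in> {0..1}"
    and "succ_enum M succs"
    and "heuristic succs H"
    and "preserves_PrIC3_inv M B lam Propagate"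
    and "PrIC3 M B lam succs H Propagate Safe_True"
  shows "Pr_max M B (init M) \<le> lam"
proof (rule PrIC3_loop_Safe_True)
  show "frame_chain M B [Phi M B (\<lambda>_. 0), \<lambda>_. 1]"
  proof -
    have "Phi M B F \<in> frames" if "F \<in> frames" for F
      using assms(1) that by (rule Phi_frames)
    from this[of "\<lambda>_. 0"] this[of "Phi M B (\<lambda>_. 0)"] show ?thesis
      by (auto simp: frame_chain_def frames_def le_fun_def)
  qed
qed (use assms in \<open>auto simp: PrIC3_def\<close>)

end
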